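(* Let $G$ be an Abelian group and $S$ a subsemigroup of $G$ with $0\in S$. The space $G_{\vec S}$ is feebly compact if and only if the subgroup $S-S$ has finite index in $G$.
   Context: For an Abelian group $G$ (written additively) and a subsemigroup $S\ni 0$ of $G$, $G_{\vec S}$ denotes the group $G$ endowed with the topology consisting of all sets $U\subseteq G$ such that for every $u\in U$ there exists $x\in S$ with $u+x+S\subseteq U$. Here $S-S=\{s-t:s,t\in S\}$. A space is feebly compact if each locally finite family of its open subsets is finite. No separation axioms are assumed. *)

theory Defs
  imports "HOL-Analysis.Abstract_Topology" "HOL-Algebra.Coset"
begin

text \<open>
  Groups are \<^locale>\<open>comm_group\<close>s and hence written multiplicatively: the set \<open>u + x + S\<close> is
  \<open>(u \<otimes> x) <# S\<close>, the difference set \<open>S - S\<close> is \<open>S <#> set_inv S\<close>, and a subsemigroup containing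
  the neutral element is a \<^const>\<open>submonoid\<close>.
\<close>

definition shift_topology :: "('a, 'b) monoid_scheme \<Rightarrow> 'a set \<Rightarrow> 'a topology" where
  "shift_topology G S =
     topology (\<lambda>U. U \<subseteq> carrier G \<and> (\<forall>u\<in>U. \<exists>x\<in>S. (u \<otimes>\<^bsub>G\<^esub> x) <#\<^bsub>G\<^esub> S \<subseteq> U))"

text \<open>
  Families are sets of open sets. Nothing is lost compared with indexed families, since
  a nonempty set cannot occur infinitely often in a locally finite indexed family.
\<close>

definition feebly_compact :: "'a topology \<Rightarrow> bool" where
  "feebly_compact X \<longleftrightarrow>
     (\<forall>\<U>. (\<forall>U\<in>\<U>. openin X U) \<and> locally_finite_in X \<U> \<longrightarrow> finite \<U>)"

text \<open>The predicate in \<open>shift_topology\<close> does define a topology, so \<^const>\<open>openin\<close> returns it.\<close>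

lemma openin_shift_topology:
  fixes G (structure)
  assumes "comm_group G" and "submonoid S G"
  shows "openin (shift_topology G S) U \<longleftrightarrow>
           U \<subseteq> carrier G \<and> (\<forall>u\<in>U. \<exists>x\<in>S. (u \<otimes> x) <# S \<subseteq> U)"
proof -
  interpret comm_group G by fact
  interpret S: submonoid S G by fact
  let ?P = "\<lambda>U. U \<subseteq> carrier G \<and> (\<forall>u\<in>U. \<exists>x\<in>S. (u \<otimes> x) <# S \<subseteq> U)"
  have shrink: "(u \<otimes> (x \<otimes> y)) <# S \<subseteq> (u \<otimes> x) <# S"
    if "u \<in> carrier G" "x \<in> S" "y \<in> S" for u x y
  proof
    fix z assume "z \<in> (u \<otimes> (x \<otimes> y)) <# S"
    then obtain s where s: "s \<in> S" "z = u \<otimes> (x \<otimes> y) \<otimes> s"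
      unfolding l_coset_def by auto
    have "z = (u \<otimes> x) \<otimes> (y \<otimes> s)"
      using s that by (simp add: m_assoc S.mem_carrier)
    then show "z \<in> (u \<otimes> x) <# S"
      unfolding l_coset_def using that s by auto
  qed
  have "?P (V \<inter> W)" if V: "?P V" and W: "?P W" for V W
  proof (intro conjI ballI)
    show "V \<inter> W \<subseteq> carrier G" using V by blast
    fix u assume u: "u \<in> V \<inter> W"
    then have uc: "u \<in> carrier G" using V by blast
    obtain x y where x: "x \<in> S" "(u \<otimes> x) <# S \<subseteq> V" and y: "y \<in> S" "(u \<otimes> y) <# S \<subseteq> W"
      using u V W by blast
    have "x \<otimes> y = y \<otimes> x" using x y by (simp add: m_comm S.mem_carrier)
    then have "(u \<otimes> (x \<otimes> y)) <# S \<subseteq> V \<inter> W"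
      using shrink[OF uc x(1) y(1)] shrink[OF uc y(1) x(1)] x(2) y(2) by auto
    then show "\<exists>x\<in>S. (u \<otimes> x) <# S \<subseteq> V \<inter> W" using x y by blast
  qed
  moreover have "?P (\<Union>\<K>)" if "\<forall>K\<in>\<K>. ?P K" for \<K>
  proof (intro conjI ballI)
    show "\<Union>\<K> \<subseteq> carrier G" using that by blast
    fix u assume "u \<in> \<Union>\<K>"
    then obtain K where "K \<in> \<K>" "u \<in> K" by blast
    moreover from this have "?P K" using that by blast
    ultimately obtain x where "x \<in> S" "(u \<otimes> x) <# S \<subseteq> K" by auto
    then show "\<exists>x\<in>S. (u \<otimes> x) <# S \<subseteq> \<Union>\<K>" using \<open>K \<in> \<K>\<close> by blast
  qed
  ultimately have "istopology ?P"
    unfolding istopology_def by simp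
  then show ?thesis
    unfolding shift_topology_def by (simp add: topology_inverse')
qed

lemma topspace_shift_topology:
  fixes G (structure)
  assumes "comm_group G" and "submonoid S G"
  shows "topspace (shift_topology G S) = carrier G"
proof -
  interpret comm_group G by fact
  interpret S: submonoid S G by fact
  have "openin (shift_topology G S) (carrier G)"
    unfolding openin_shift_topology[OF assms]
    using S.one_closed by (auto simp: l_coset_def S.mem_carrier intro!: bexI[of _ \<one>])
  then show ?thesis
    using openin_shift_topology[OF assms] by (metis openin_subset openin_topspace subset_antisym)
qed

end

theory Submission imports Defs begin

text \<open>
  The cosets of \<open>S - S\<close> are open and partition the group, so they form a locally finite open
  family. Conversely, two points of one coset have intersecting forward translates of \<open>S\<close>, so any
  two open sets meeting the same coset intersect. Hence only finitely many members of a locally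
  finite open family meet a given coset, and with finitely many cosets the family is finite.
\<close>

text \<open>Commutativity is what makes this work: a product of two quotients regroups into one
  quotient, and inverting a quotient swaps its numerator and denominator, both still in
  \<open>S\<close>.\<close>

lemma (in comm_group) subgroup_set_mult_set_inv:
  assumes "submonoid S G"
  shows "subgroup (S <#> set_inv S) G"
proof (rule subgroupI)
  interpret S: submonoid S G by fact
  show "S <#> set_inv S \<subseteq> carrier G"
    by (auto simp: set_mult_def SET_INV_def S.mem_carrier)
  have "\<one> \<otimes> inv \<one> \<in> S <#> set_inv S"
    unfolding set_mult_def SET_INV_def using S.one_closed by blast
  then show "S <#> set_inv S \<noteq> {}" by blast
next
  interpret S: submonoid S G by fact
  fix h assume "h \<in> S <#> set_inv S"
  then obtain a b where ab: "a \<in> S" "b \<in> S" "h = a \<otimes> inv b"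
    by (auto simp: set_mult_def SET_INV_def)
  then have "inv h = b \<otimes> inv a"
    by (simp add: inv_mult S.mem_carrier m_comm)
  then show "inv h \<in> S <#> set_inv S"
    using ab by (auto simp: set_mult_def SET_INV_def)
  fix k assume "k \<in> S <#> set_inv S"
  then obtain c d where cd: "c \<in> S" "d \<in> S" "k = c \<otimes> inv d"
    by (auto simp: set_mult_def SET_INV_def)
  have "h \<otimes> k = (a \<otimes> c) \<otimes> inv (b \<otimes> d)"
    using ab cd by (simp add: inv_mult S.mem_carrier m_ac)
  then show "h \<otimes> k \<in> S <#> set_inv S"
    using ab cd by (auto simp: set_mult_def SET_INV_def)
qed

text \<open>Denominator \<one> suffices. This makes each coset of \<open>S <#> set_inv S\<close>
  stable under multiplication by \<open>S\<close>.\<close>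

lemma (in comm_group) subset_set_mult_set_inv:
  assumes "submonoid S G"
  shows "S \<subseteq> S <#> set_inv S"
proof
  interpret S: submonoid S G by fact
  fix s assume s: "s \<in> S"
  then have "s = s \<otimes> inv \<one>" by (simp add: S.mem_carrier)
  then show "s \<in> S <#> set_inv S"
    unfolding set_mult_def SET_INV_def using s S.one_closed by blast
qed

text \<open>Clearing denominators: for \<open>p = a \<otimes> inv b \<otimes> g\<close> and
  \<open>q = c \<otimes> inv d \<otimes> g\<close>, multiplying each point by its own denominator
  and the other's numerator gives \<open>a \<otimes> c \<otimes> g\<close> both times.\<close>

lemma (in comm_group) rcoset_common_translate:
  assumes "submonoid S G" and C: "C \<in> rcosets (S <#> set_inv S)" "p \<in> C" "q \<in> C"
  obtains s t where "s \<in> S" "t \<in> S" "p \<otimes> s = q \<otimes> t"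
proof -
  interpret S: submonoid S G by fact
  obtain g a b c d where g: "g \<in> carrier G"
    and S: "a \<in> S" "b \<in> S" "c \<in> S" "d \<in> S"
    and pq: "p = a \<otimes> inv b \<otimes> g" "q = c \<otimes> inv d \<otimes> g"
    using C by (auto simp: RCOSETS_def r_coset_def set_mult_def SET_INV_def)
  note mem = g S[THEN S.mem_carrier]
  \<comment> \<open>The trivial factor \<open>b \<otimes> inv b\<close> is kept and then traded for
    \<open>d \<otimes> inv d\<close>, so that the first and last equalities are pure
    rearrangements.\<close>
  have "p \<otimes> (b \<otimes> c) = (b \<otimes> inv b) \<otimes> (a \<otimes> c \<otimes> g)"
    by (simp only: pq m_ac m_closed inv_closed mem)
  also have "\<dots> = (d \<otimes> inv d) \<otimes> (a \<otimes> c \<otimes> g)" by (simp add: mem)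
  also have "\<dots> = q \<otimes> (d \<otimes> a)"
    by (simp only: pq m_ac m_closed inv_closed mem)
  finally show thesis using S by (intro that) auto
qed

text \<open>A coset absorbs multiplication by \<open>S\<close>, so the shift \<one> serves at each
  of its points.\<close>

lemma (in comm_group) openin_shift_topology_rcoset:
  assumes S: "submonoid S G" and C: "C \<in> rcosets (S <#> set_inv S)"
  shows "openin (shift_topology G S) C"
  unfolding openin_shift_topology[OF comm_group_axioms S]
proof (intro conjI ballI)
  interpret S: submonoid S G by fact
  interpret H: subgroup "S <#> set_inv S" G by (rule subgroup_set_mult_set_inv[OF S])
  show "C \<subseteq> carrier G" using C H.rcosets_carrier[OF is_group] by blast
  fix u assume "u \<in> C"
  then obtain h g where g: "g \<in> carrier G" and h: "h \<in> S <#> set_inv S"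
    and u: "u = h \<otimes> g" and C': "C = (S <#> set_inv S) #> g"
    using C by (auto simp: RCOSETS_def r_coset_def)
  have "u \<otimes> \<one> \<otimes> s \<in> C" if s: "s \<in> S" for s
  proof -
    have "h \<otimes> s \<in> S <#> set_inv S"
      using h s subset_set_mult_set_inv[OF S] by blast
    moreover have "u \<otimes> \<one> \<otimes> s = h \<otimes> s \<otimes> g"
      using g h s u by (simp add: H.mem_carrier S.mem_carrier m_ac)
    ultimately show ?thesis unfolding C' r_coset_def by blast
  qed
  then show "\<exists>x\<in>S. (u \<otimes> x) <# S \<subseteq> C"
    by (intro bexI[of _ \<one>]) (auto simp: l_coset_def)
qed

lemma (in comm_group) openin_shift_topology_meet:
  assumes S: "submonoid S G" and C: "C \<in> rcosets (S <#> set_inv S)"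
    and U: "openin (shift_topology G S) U" "U \<inter> C \<noteq> {}"
    and V: "openin (shift_topology G S) V" "V \<inter> C \<noteq> {}"
  shows "U \<inter> V \<noteq> {}"
proof -
  interpret S: submonoid S G by fact
  obtain p q where p: "p \<in> U" "p \<in> C" and q: "q \<in> V" "q \<in> C" using U V by blast
  obtain x y where x: "x \<in> S" "(p \<otimes> x) <# S \<subseteq> U" and y: "y \<in> S" "(q \<otimes> y) <# S \<subseteq> V"
    using U V p q unfolding openin_shift_topology[OF comm_group_axioms S] by meson
  have pq: "p \<in> carrier G" "q \<in> carrier G"
    using U V p q unfolding openin_shift_topology[OF comm_group_axioms S] by auto
  obtain s t where st: "s \<in> S" "t \<in> S" "p \<otimes> s = q \<otimes> t"
    using rcoset_common_translate[OF S C p(2) q(2)] .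
  \<comment> \<open>Multiplying the common translate \<open>p \<otimes> s = q \<otimes> t\<close> by
    \<open>x \<otimes> y\<close> pushes it far enough to lie in both
    \<open>(p \<otimes> x) <# S\<close> and \<open>(q \<otimes> y) <# S\<close>.\<close>
  have "(p \<otimes> x) \<otimes> (s \<otimes> y) = (p \<otimes> s) \<otimes> (x \<otimes> y)"
    using pq x y st(1,2) by (simp add: S.mem_carrier m_ac)
  also have "\<dots> = (q \<otimes> y) \<otimes> (t \<otimes> x)"
    unfolding st(3) using pq x y st(1,2) by (simp add: S.mem_carrier m_ac)
  finally have "(p \<otimes> x) \<otimes> (s \<otimes> y) \<in> (q \<otimes> y) <# S"
    using st x by (auto simp: l_coset_def)
  moreover have "(p \<otimes> x) \<otimes> (s \<otimes> y) \<in> (p \<otimes> x) <# S"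
    using st y by (auto simp: l_coset_def)
  ultimately show ?thesis using x y by blast
qed

theorem proposition5p15:
  fixes G (structure) and S :: "'a set"
  assumes "comm_group G" and "submonoid S G"
  shows "feebly_compact (shift_topology G S) \<longleftrightarrow> finite (rcosets (S <#> set_inv S))"
proof -
  interpret comm_group G by fact
  let ?H = "S <#> set_inv S" and ?X = "shift_topology G S"
  have H: "subgroup ?H G" using assms(2) by (rule subgroup_set_mult_set_inv)
  note cover = rcosets_part_G[OF H]
  note top = topspace_shift_topology[OF assms]
  note rc_open = openin_shift_topology_rcoset[OF assms(2)]
  show ?thesis
  proof
    assume "feebly_compact ?X"
    moreover have "locally_finite_in ?X (rcosets ?H)"
      unfolding locally_finite_in_def top
    proof (intro conjI ballI)
      show "\<Union>(rcosets ?H) \<subseteq> carrier G" using cover by simp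
      fix x assume "x \<in> carrier G"
      \<comment> \<open>The coset of \<open>x\<close> serves as its neighbourhood: by disjointness
        it meets no other coset.\<close>
      then obtain C where C: "C \<in> rcosets ?H" "x \<in> C" using cover by blast
      then have "{D \<in> rcosets ?H. D \<inter> C \<noteq> {}} \<subseteq> {C}"
        using rcos_disjoint[OF H] by (auto simp: pairwise_def disjnt_def)
      then have "finite {D \<in> rcosets ?H. D \<inter> C \<noteq> {}}" using finite_subset by blast
      then show "\<exists>V. openin ?X V \<and> x \<in> V \<and> finite {D \<in> rcosets ?H. D \<inter> V \<noteq> {}}"
        using C rc_open by blast
    qed
    ultimately show "finite (rcosets ?H)"
      using rc_open unfolding feebly_compact_def by blast
  next
    assume fin: "finite (rcosets ?H)"
    show "feebly_compact ?X"
      unfolding feebly_compact_def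
    proof (intro allI impI, elim conjE)
      fix \<U> assume op: "\<forall>U\<in>\<U>. openin ?X U" and lf: "locally_finite_in ?X \<U>"
      have "finite {U \<in> \<U>. U \<inter> C \<noteq> {}}" if C: "C \<in> rcosets ?H" for C
      proof -
        \<comment> \<open>A single point controls the whole coset: a neighbourhood \<open>V\<close>
          of \<open>g\<close> meets every open set that meets \<open>C\<close>, so the finiteness at
          \<open>V\<close> bounds all members meeting \<open>C\<close>.\<close>
        obtain g where g: "g \<in> C" "g \<in> carrier G"
          using C cover subgroup.rcosets_non_empty[OF H C] by blast
        then obtain V where V: "openin ?X V" "g \<in> V" "finite {U \<in> \<U>. U \<inter> V \<noteq> {}}"
          using lf unfolding locally_finite_in_def top by blast
        have "{U \<in> \<U>. U \<inter> C \<noteq> {}} \<subseteq> {U \<in> \<U>. U \<inter> V \<noteq> {}}"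
          using openin_shift_topology_meet[OF assms(2) C] op V g by blast
        then show ?thesis using V(3) finite_subset by blast
      qed
      \<comment> \<open>The empty set may belong to \<open>\<U>\<close> but meets no coset, so it is
        added separately.\<close>
      then have "finite (insert {} (\<Union>C\<in>rcosets ?H. {U \<in> \<U>. U \<inter> C \<noteq> {}}))"
        using fin by blast
      moreover have "\<U> \<subseteq> insert {} (\<Union>C\<in>rcosets ?H. {U \<in> \<U>. U \<inter> C \<noteq> {}})"
      proof
        fix U assume U: "U \<in> \<U>"
        then have "U \<subseteq> \<Union>(rcosets ?H)" using op openin_subset top cover by metis
        then show "U \<in> insert {} (\<Union>C\<in>rcosets ?H. {U \<in> \<U>. U \<inter> C \<noteq> {}})"
          using U by blast
      qed
      ultimately show "finite \<U>" by (rule rev_finite_subset)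
    qed
  qed
qed

end
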